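(* Let $g\colon\mathbf{R}^n\to\mathbf{R}\cup\{+\infty\}$ be a proper closed convex function, $h\colon\mathbf{R}^m\to\mathbf{R}$ a finite-valued convex function that is $L$-Lipschitz continuous, and $c\colon\mathbf{R}^n\to\mathbf{R}^m$ a $C^1$-smooth mapping whose Jacobian $\nabla c$ is $\beta$-Lipschitz continuous. Let $\varphi(x):=g(x)+h(c(x))$, let $t>0$, let $\bar x$ be a stationary point of $\varphi$ (i.e. $0\in\partial\varphi(\bar x)$), and consider the conditions: (i) the subdifferential $\partial\varphi$ is subregular at $(\bar x,0)$ with constant $l$; (ii) the prox-gradient mapping $\mathcal{G}_t(\cdot)$ is subregular at $(\bar x,0)$ with constant $\hat l$. If (ii) holds, then (i) holds with $l:=2\hat l$. Conversely, if (i) holds, then (ii) holds with $\hat l:=(3L\beta t+2)l+2t$.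
   Context: For $x,y\in\mathbf{R}^n$ set $\varphi(x;y):=g(y)+h\big(c(x)+\nabla c(x)(y-x)\big)$ and $\varphi_t(x;y):=\varphi(x;y)+\frac1{2t}\|x-y\|^2$. Define $x^t:=\operatorname{argmin}_y\varphi_t(x;y)$ and $\mathcal{G}_t(x):=t^{-1}(x-x^t)$. The subdifferential is $\partial\varphi(x):=\partial g(x)+\nabla c(x)^T\partial h(c(x))$, with $\partial g,\partial h$ convex subdifferentials. A set-valued mapping $F\colon\mathbf{R}^n\rightrightarrows\mathbf{R}^m$ is subregular at $(\bar x,\bar y)\in\mathrm{gph}\,F$ with constant $l>0$ if there is a neighborhood $\mathcal{X}$ of $\bar x$ with $\mathrm{dist}\big(x;F^{-1}(\bar y)\big)\le l\cdot\mathrm{dist}\big(\bar y;F(x)\big)$ for all $x\in\mathcal{X}$, where $F^{-1}(y)=\{x:y\in F(x)\}$ and the distance to the empty set is $+\infty$. *)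

theory Defs
  imports "HOL-Analysis.Analysis"
begin

text \<open>Functions into \<open>\<real> \<union> {+\<infinity>}\<close> are \<open>ereal\<close>-valued functions that never take the value \<open>-\<infinity>\<close>.\<close>

definition ereal_epigraph :: "('a \<Rightarrow> ereal) \<Rightarrow> ('a \<times> real) set" where
  "ereal_epigraph f = {(x, r). f x \<le> ereal r}"

definition proper_closed_convex :: "('a::real_normed_vector \<Rightarrow> ereal) \<Rightarrow> bool" where
  "proper_closed_convex f \<longleftrightarrow>
     (\<forall>x. f x \<noteq> -\<infinity>) \<and> (\<exists>x. f x < \<infinity>) \<and>
     closed (ereal_epigraph f) \<and> convex (ereal_epigraph f)"

text \<open>The convex subdifferential; it is empty outside the effective domain.\<close>

definition subdiff :: "('a::real_inner \<Rightarrow> ereal) \<Rightarrow> 'a \<Rightarrow> 'a set" where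
  "subdiff f x = {v. \<bar>f x\<bar> \<noteq> \<infinity> \<and> (\<forall>y. f y \<ge> f x + ereal (v \<bullet> (y - x)))}"

text \<open>The distance to the empty set is \<open>+\<infinity>\<close>; the library function \<open>infdist\<close> uses 0 instead.\<close>

definition edist_set :: "'a::metric_space \<Rightarrow> 'a set \<Rightarrow> ereal" where
  "edist_set x S = (INF s\<in>S. ereal (dist x s))"

definition subregular ::
    "('a::metric_space \<Rightarrow> 'b::metric_space set) \<Rightarrow> 'a \<Rightarrow> 'b \<Rightarrow> real \<Rightarrow> bool" where
  "subregular F xbar ybar l \<longleftrightarrow>
     ybar \<in> F xbar \<and> l > 0 \<and>
     (\<forall>\<^sub>F x in nhds xbar.
        edist_set x {z. ybar \<in> F z} \<le> ereal l * edist_set ybar (F x))"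

text \<open>For a proper closed convex \<open>g\<close>, a finite convex \<open>h\<close> and a smooth \<open>c\<close>, the set
  \<open>\<partial>\<phi>(x) = \<partial>g(x) + \<nabla>c(x)\<^sup>T \<partial>h(c(x))\<close> of the composite function \<open>\<phi> = g + h \<circ> c\<close>.
  It is a function of the triple \<open>(g, h, c)\<close>.\<close>

definition composite_subdiff ::
    "(real^'n \<Rightarrow> ereal) \<Rightarrow> (real^'m \<Rightarrow> real) \<Rightarrow> (real^'n \<Rightarrow> real^'m) \<Rightarrow> real^'n \<Rightarrow> (real^'n) set" where
  "composite_subdiff g h c x =
     {v + transpose (jacobian c (at x)) *v w | v w.
        v \<in> subdiff g x \<and> w \<in> subdiff (\<lambda>z. ereal (h z)) (c x)}"

definition linearized ::
    "(real^'n \<Rightarrow> ereal) \<Rightarrow> (real^'m \<Rightarrow> real) \<Rightarrow> (real^'n \<Rightarrow> real^'m) \<Rightarrow> real^'n \<Rightarrow> real^'n \<Rightarrow> ereal" where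
  "linearized g h c x y = g y + ereal (h (c x + jacobian c (at x) *v (y - x)))"

definition prox_model ::
    "(real^'n \<Rightarrow> ereal) \<Rightarrow> (real^'m \<Rightarrow> real) \<Rightarrow> (real^'n \<Rightarrow> real^'m) \<Rightarrow> real \<Rightarrow>
     real^'n \<Rightarrow> real^'n \<Rightarrow> ereal" where
  "prox_model g h c t x y = linearized g h c x y + ereal (1 / (2 * t) * (norm (x - y))\<^sup>2)"

text \<open>Under the standing assumptions the model is strongly convex, proper and closed for \<open>t > 0\<close>,
  so its minimizer exists and is unique and the choice made by \<open>arg_min\<close> is irrelevant.\<close>

definition prox_point ::
    "(real^'n \<Rightarrow> ereal) \<Rightarrow> (real^'m \<Rightarrow> real) \<Rightarrow> (real^'n \<Rightarrow> real^'m) \<Rightarrow> real \<Rightarrow> real^'n \<Rightarrow> real^'n" where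
  "prox_point g h c t x = (ARG_MIN (prox_model g h c t x) y. True)"

definition prox_gradient ::
    "(real^'n \<Rightarrow> ereal) \<Rightarrow> (real^'m \<Rightarrow> real) \<Rightarrow> (real^'n \<Rightarrow> real^'m) \<Rightarrow> real \<Rightarrow> real^'n \<Rightarrow> real^'n" where
  "prox_gradient g h c t x = (1 / t) *\<^sub>R (x - prox_point g h c t x)"

end

theory Submission
  imports Defs
begin

text \<open>The composite subdifferential at \<open>x\<close> is the convex subdifferential at \<open>x\<close> of the linearized
  model, so stationary points are exactly the zeros of the prox-gradient map, and strong convexity of
  the proximal model gives \<open>\<parallel>\<G>\<^sub>t(x)\<parallel> \<le> dist(0; \<partial>\<phi>(x))\<close>; hence (ii) implies (i).
  For the converse, near \<open>x\<^sup>t\<close> there is a point \<open>y\<close> with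
  \<open>\<parallel>y - x\<^sup>t\<parallel> \<le> \<parallel>x\<^sup>t - x\<parallel>\<close> and \<open>dist(0; \<partial>\<phi>(y)) \<le> (3L\<beta>t + 2) \<parallel>\<G>\<^sub>t(x)\<parallel>\<close>.
  Since \<open>\<parallel>x\<^sup>t - x\<parallel> = O(\<parallel>x - xbar\<parallel>)\<close>, subregularity of \<open>\<partial>\<phi>\<close> applies at \<open>y\<close>, and \<open>\<parallel>x - y\<parallel> \<le> 2t \<parallel>\<G>\<^sub>t(x)\<parallel>\<close>
  by the triangle inequality.\<close>

section \<open>Convex epigraphs and subgradients at composite minimizers\<close>

text \<open>Since \<open>F\<close> is finite, a pair \<open>(y, r)\<close> lies in the epigraph of
  the sum iff \<open>(y, r - F y)\<close> lies in that of \<open>G\<close>. Convexity of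
  \<open>F\<close> then pushes the combined height in the right direction.\<close>

lemma ereal_epigraph_add_real_convex:
  assumes "convex (ereal_epigraph G)" "convex_on UNIV F"
  shows "convex (ereal_epigraph (\<lambda>y. G y + ereal (F y)))"
proof -
  have mem: "(y, r) \<in> ereal_epigraph (\<lambda>y. G y + ereal (F y)) \<longleftrightarrow> (y, r - F y) \<in> ereal_epigraph G"
    for y r
    by (cases "G y") (auto simp: ereal_epigraph_def)
  show ?thesis
  proof (rule convexI)
    fix p q and u v :: real
    assume p: "p \<in> ereal_epigraph (\<lambda>y. G y + ereal (F y))"
      and q: "q \<in> ereal_epigraph (\<lambda>y. G y + ereal (F y))"
      and uv: "0 \<le> u" "0 \<le> v" "u + v = 1"
    obtain y r z s where pq: "p = (y, r)" "q = (z, s)"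
      by (cases p, cases q)
    have "u *\<^sub>R (y, r - F y) + v *\<^sub>R (z, s - F z) \<in> ereal_epigraph G"
      using p q uv by (intro convexD[OF assms(1)]) (auto simp: pq mem)
    then have 1: "G (u *\<^sub>R y + v *\<^sub>R z) \<le> ereal (u * (r - F y) + v * (s - F z))"
      by (simp add: ereal_epigraph_def)
    have "F (u *\<^sub>R y + v *\<^sub>R z) \<le> u * F y + v * F z"
      using assms(2) uv by (auto simp: convex_on_def)
    then have "ereal (u * (r - F y) + v * (s - F z))
        \<le> ereal (u * r + v * s - F (u *\<^sub>R y + v *\<^sub>R z))"
      by (simp add: algebra_simps)
    with 1 have "G (u *\<^sub>R y + v *\<^sub>R z) \<le> ereal (u * r + v * s - F (u *\<^sub>R y + v *\<^sub>R z))"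
      by (rule order_trans)
    then have "(u *\<^sub>R y + v *\<^sub>R z, u * r + v * s) \<in> ereal_epigraph (\<lambda>y. G y + ereal (F y))"
      unfolding mem by (simp add: ereal_epigraph_def)
    then show "u *\<^sub>R p + v *\<^sub>R q \<in> ereal_epigraph (\<lambda>y. G y + ereal (F y))"
      by (simp add: pq)
  qed
qed

text \<open>Fermat's rule combined with the sum and chain rules. No constraint qualification is needed
  since \<open>H\<close> is finite: the strict hypograph of \<open>m - H\<close> projects onto the whole space, so a
  hyperplane separating it from the image of the epigraph of \<open>G\<close> cannot be vertical.\<close>

lemma composite_minimizer_subgradient:
  fixes G :: "'a::euclidean_space \<Rightarrow> ereal" and H :: "'b::euclidean_space \<Rightarrow> real"
  assumes G: "convex (ereal_epigraph G)" and fin: "\<bar>G x\<bar> \<noteq> \<infinity>"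
    and H: "convex_on UNIV H" and A: "linear A"
    and min: "\<And>y. G x + ereal (H b) \<le> G y + ereal (H (b + A (y - x)))"
  shows "\<exists>w \<in> subdiff (\<lambda>z. ereal (H z)) b. \<forall>y. G x \<le> G y + ereal (w \<bullet> A (y - x))"
proof -
  obtain \<gamma> where \<gamma>: "G x = ereal \<gamma>" using fin by auto
  define P where "P = (\<lambda>p. (A (fst p), snd p)) ` ereal_epigraph G"
  \<comment> \<open>\<open>min\<close> says that no point of \<open>P\<close> lies in
    \<open>Q\<close>. The strict inequality in \<open>Q\<close> keeps the two sets disjoint although
    \<open>(A x, \<gamma>)\<close> is in \<open>P\<close> and on the boundary of
    \<open>Q\<close>.\<close>
  define Q where "Q = {(z, r). r < \<gamma> + H b - H (b + (z - A x))}"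
  have "linear (\<lambda>p::'a \<times> real. (A (fst p), snd p))"
    by (intro linearI) (auto simp: linear_add[OF A] linear_scale[OF A])
  then have "convex P"
    unfolding P_def using G by (rule convex_linear_image)
  moreover have "convex Q"
  proof (rule convexI)
    fix p q and u v :: real
    assume p: "p \<in> Q" and q: "q \<in> Q" and uv: "0 \<le> u" "0 \<le> v" "u + v = 1"
    obtain y r z s where pq: "p = (y, r)" "q = (z, s)"
      by (cases p, cases q)
    have "H (u *\<^sub>R (b + (y - A x)) + v *\<^sub>R (b + (z - A x)))
        \<le> u * H (b + (y - A x)) + v * H (b + (z - A x))"
      using H uv by (auto simp: convex_on_def)
    also have "u *\<^sub>R (b + (y - A x)) + v *\<^sub>R (b + (z - A x)) =
        (u + v) *\<^sub>R (b - A x) + (u *\<^sub>R y + v *\<^sub>R z)"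
      by (simp add: algebra_simps)
    finally have 1: "H (b + (u *\<^sub>R y + v *\<^sub>R z - A x))
        \<le> u * H (b + (y - A x)) + v * H (b + (z - A x))"
      by (simp add: uv algebra_simps)
    have "u * r + v * s < u * (\<gamma> + H b - H (b + (y - A x))) + v * (\<gamma> + H b - H (b + (z - A x)))"
    \<comment> \<open>Strictness survives only through a positive weight: \<open>u\<close> if it is
      nonzero, otherwise \<open>v = 1\<close>.\<close>
    proof (cases "u = 0")
      case True
      then show ?thesis using p q uv by (auto simp: Q_def pq)
    next
      case False
      then have "u * r < u * (\<gamma> + H b - H (b + (y - A x)))"
        using p uv by (auto simp: Q_def pq)
      moreover have "v * s \<le> v * (\<gamma> + H b - H (b + (z - A x)))"
        using q uv by (intro mult_left_mono) (auto simp: Q_def pq)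
      ultimately show ?thesis by simp
    qed
    also have "\<dots> = (u + v) * (\<gamma> + H b) - (u * H (b + (y - A x)) + v * H (b + (z - A x)))"
      by (simp add: algebra_simps)
    finally show "u *\<^sub>R p + v *\<^sub>R q \<in> Q"
      using 1 uv by (simp add: Q_def pq)
  qed
  moreover have P0: "(A x, \<gamma>) \<in> P"
    using \<gamma> by (force simp: P_def ereal_epigraph_def)
  moreover have Q0: "(A x, \<gamma> - 1) \<in> Q"
    by (simp add: Q_def)
  moreover have "Q \<inter> P = {}"
  proof (rule ccontr)
    assume "Q \<inter> P \<noteq> {}"
    then obtain y r where yr: "G y \<le> ereal r" "r < \<gamma> + H b - H (b + (A y - A x))"
      by (auto simp: P_def Q_def ereal_epigraph_def)
    have "G x + ereal (H b) \<le> G y + ereal (H (b + A (y - x)))" by (rule min)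
    also have "\<dots> \<le> ereal r + ereal (H (b + A (y - x)))"
      using yr by (intro add_right_mono)
    finally show False
      using yr by (simp add: \<gamma> linear_diff[OF A])
  qed
  ultimately obtain a \<beta> where a: "a \<noteq> 0" "\<And>q. q \<in> Q \<Longrightarrow> a \<bullet> q \<le> \<beta>" "\<And>p. p \<in> P \<Longrightarrow> a \<bullet> p \<ge> \<beta>"
    using separating_hyperplane_sets[of Q P] by (metis empty_iff)
  obtain u s where us: "a = (u, s)" by (cases a)
  have sep: "u \<bullet> z + s * r \<le> u \<bullet> z' + s * r'" if "(z, r) \<in> Q" "(z', r') \<in> P" for z r z' r'
    using a(2)[OF that(1)] a(3)[OF that(2)] by (simp add: us)
  have "s \<ge> 0"
    using sep[OF Q0 P0] by (simp add: algebra_simps)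
  moreover have "s \<noteq> 0"
  proof
    assume s: "s = 0"
    then have "u \<noteq> 0" using a us by (auto simp: zero_prod_def)
    have "(A x + u, \<gamma> + H b - H (b + (A x + u - A x)) - 1) \<in> Q"
      by (simp add: Q_def)
    from sep[OF this P0] have "u \<bullet> u \<le> 0"
      by (simp add: s inner_right_distrib)
    with \<open>u \<noteq> 0\<close> show False by (metis inner_gt_zero_iff not_le)
  qed
  ultimately have s: "s > 0" by simp
  define w where "w = u /\<^sub>R s"
  have u: "u = s *\<^sub>R w" using s by (simp add: w_def)
  \<comment> \<open>The heights in \<open>Q\<close> are strict, so the inequality on its boundary is
    reached by lowering the height by \<open>e\<close> and letting \<open>e\<close> tend to
    0.\<close>
  have sep': "w \<bullet> z + (\<gamma> + H b - H (b + (z - A x))) \<le> w \<bullet> z' + r'" if "(z', r') \<in> P" for z z' r'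
  proof (rule field_le_epsilon)
    fix e :: real assume "e > 0"
    then have "(z, \<gamma> + H b - H (b + (z - A x)) - e) \<in> Q"
      by (simp add: Q_def)
    from sep[OF this that] have "s * (w \<bullet> z + (\<gamma> + H b - H (b + (z - A x)) - e)) \<le> s * (w \<bullet> z' + r')"
      by (simp add: u algebra_simps)
    then show "w \<bullet> z + (\<gamma> + H b - H (b + (z - A x))) \<le> w \<bullet> z' + r' + e"
      using s by simp
  qed
  \<comment> \<open>Fixing the contact point \<open>(A x, \<gamma>)\<close> in \<open>P\<close>
    leaves the subgradient inequality for \<open>H\<close>. Fixing \<open>z = A x\<close> on the
    side of \<open>Q\<close> leaves the inequality for \<open>G\<close>, shown next.\<close>
  have "w \<in> subdiff (\<lambda>z. ereal (H z)) b"
    unfolding subdiff_def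
  proof safe
    fix z
    show "ereal (H b) + ereal (w \<bullet> (z - b)) \<le> ereal (H z)"
      using sep'[OF P0, of "z - b + A x"] by (simp add: algebra_simps inner_right_distrib)
  qed auto
  moreover have "G x \<le> G y + ereal (w \<bullet> A (y - x))" for y
  proof (cases "G y")
    case (real r)
    then have "(A y, r) \<in> P" by (force simp: P_def ereal_epigraph_def)
    from sep'[OF this, of "A x"] show ?thesis
      by (simp add: \<gamma> real linear_diff[OF A] inner_diff_right)
  next
    case MInf
    have "G x + ereal (H b) \<le> G y + ereal (H (b + A (y - x)))" by (rule min)
    then show ?thesis by (simp add: \<gamma> MInf)
  qed simp
  ultimately show ?thesis by blast
qed

section \<open>Existence of minimizers by the direct method\<close>

text \<open>A point one unit below the graph is strictly separated from the closed convex epigraph.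
  The hyperplane is not vertical, hence it is an affine minorant, here weakened to a radial bound
  centred at \<open>x\<close>.\<close>

lemma proper_closed_convex_minorant:
  fixes g :: "'a::euclidean_space \<Rightarrow> ereal"
  assumes g: "proper_closed_convex g"
  obtains M where "M \<ge> 0" "\<And>y. g y \<ge> ereal (- M * (norm (y - x) + 1))"
proof -
  obtain y0 where "g y0 < \<infinity>" "g y0 \<noteq> -\<infinity>"
    using g by (auto simp: proper_closed_convex_def)
  then obtain \<gamma> where \<gamma>: "g y0 = ereal \<gamma>" by (cases "g y0") auto
  then have "(y0, \<gamma> - 1) \<notin> ereal_epigraph g" and mem: "(y0, \<gamma>) \<in> ereal_epigraph g"
    by (auto simp: ereal_epigraph_def)
  then obtain a \<beta> where a: "a \<bullet> (y0, \<gamma> - 1) < \<beta>" "\<And>p. p \<in> ereal_epigraph g \<Longrightarrow> a \<bullet> p > \<beta>"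
    using separating_hyperplane_closed_point[of "ereal_epigraph g" "(y0, \<gamma> - 1)"] g
    unfolding proper_closed_convex_def by metis
  obtain u s where us: "a = (u, s)" by (cases a)
  \<comment> \<open>The separated point and \<open>(y0, \<gamma>)\<close> differ only in height, so
    comparing them isolates \<open>s\<close>.\<close>
  have s: "s > 0"
    using a(1) a(2)[OF mem] by (simp add: us algebra_simps)
  define N where "N = \<bar>\<beta>\<bar> + norm u * (norm x + 1)"
  show thesis
  proof
    show "N / s \<ge> 0" using s by (simp add: N_def)
    fix y
    show "g y \<ge> ereal (- (N / s) * (norm (y - x) + 1))"
    proof (cases "g y")
      case (real r)
      then have "(y, r) \<in> ereal_epigraph g" by (simp add: ereal_epigraph_def)
      from a(2)[OF this] have 1: "\<beta> < u \<bullet> y + s * r" by (simp add: us)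
      have "u \<bullet> y \<le> norm u * norm y" by (rule norm_cauchy_schwarz)
      also have "\<dots> \<le> norm u * (norm (y - x) + norm x)"
        by (intro mult_left_mono norm_ge_zero) (use norm_triangle_sub[of y x] in linarith)
      also have "\<bar>\<beta>\<bar> + \<dots> \<le> N * (norm (y - x) + 1)"
        by (simp add: N_def algebra_simps)
      finally have "- (N * (norm (y - x) + 1)) \<le> s * r" using 1 by simp
      then have "- (N * (norm (y - x) + 1)) / s \<le> r"
        using s by (simp add: field_simps)
      then show ?thesis by (simp add: real)
    next
      case MInf
      then show ?thesis using g by (auto simp: proper_closed_convex_def)
    qed simp
  qed
qed

text \<open>Quadratic growth of \<open>F\<close> beats the linear decrease allowed by the minorant
  of \<open>g\<close>, so a sublevel set is compact. The minimum is taken over pairs in the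
  epigraph, where the objective \<open>snd p + F (fst p)\<close> is continuous even if
  \<open>g\<close> is only lower semicontinuous.\<close>

lemma coercive_minimizer_exists:
  fixes g :: "'a::euclidean_space \<Rightarrow> ereal"
  assumes g: "proper_closed_convex g" and F: "continuous_on UNIV F"
    and \<kappa>: "\<kappa> > 0" and K: "K \<ge> 0"
    and coercive: "\<And>y. F y \<ge> \<kappa> * (norm (y - x))\<^sup>2 - K * (norm (y - x) + 1)"
  obtains y where "\<And>z. g y + ereal (F y) \<le> g z + ereal (F z)" "\<bar>g y\<bar> \<noteq> \<infinity>"
proof -
  obtain M where M: "M \<ge> 0" "\<And>y. g y \<ge> ereal (- M * (norm (y - x) + 1))"
    using proper_closed_convex_minorant[OF g, of x] by metis
  obtain y0 where "g y0 < \<infinity>" "g y0 \<noteq> -\<infinity>"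
    using g by (auto simp: proper_closed_convex_def)
  then obtain \<gamma> where \<gamma>: "g y0 = ereal \<gamma>" by (cases "g y0") auto
  define \<alpha> where "\<alpha> = \<gamma> + F y0"
  define T where "T = ereal_epigraph g \<inter> {p. snd p + F (fst p) \<le> \<alpha>}"
  define N where "N = K + M + \<bar>\<alpha>\<bar>"
  \<comment> \<open>For \<open>n > 1\<close> the bound
    \<open>\<kappa> * n\<^sup>2 \<le> N * (n + 2)\<close> proved below and
    \<open>n + 2 \<le> 3 * n\<close> give \<open>n \<le> 3 * N / \<kappa>\<close>; the summand 1
    covers \<open>n \<le> 1\<close>.\<close>
  define R where "R = 1 + 3 * N / \<kappa>"
  have N: "N \<ge> 0" using K M by (simp add: N_def)
  have cont: "continuous_on S (\<lambda>p::'a \<times> real. snd p + F (fst p))" for S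
    by (intro continuous_intros continuous_on_compose2[OF F]) auto
  have bound: "norm (y - x) \<le> R \<and> r \<in> {- (M * (R + 1)) .. \<alpha> + K * (R + 1)}" if "(y, r) \<in> T" for y r
  proof -
    define n where "n = norm (y - x)"
    have n: "n \<ge> 0" by (simp add: n_def)
    have T: "g y \<le> ereal r" "r + F y \<le> \<alpha>"
      using that by (auto simp: T_def ereal_epigraph_def)
    have r: "- M * (n + 1) \<le> r"
      using M(2)[of y] T(1) unfolding n_def by (metis ereal_less_eq(3) order_trans)
    have Fy: "\<kappa> * n\<^sup>2 - K * (n + 1) \<le> F y" using coercive[of y] by (simp add: n_def)
    have "\<kappa> * n\<^sup>2 \<le> (K + M) * (n + 1) + \<bar>\<alpha>\<bar>"
      using r Fy T(2) by (simp add: algebra_simps)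
    also have "\<dots> \<le> N * (n + 2)"
      using n K M by (simp add: N_def algebra_simps)
    finally have q: "\<kappa> * n\<^sup>2 \<le> N * (n + 2)" .
    have nR: "n \<le> R"
    proof (cases "n \<le> 1")
      case True
      then show ?thesis using N \<kappa> by (simp add: R_def add_increasing2)
    next
      case False
      then have "N * (n + 2) \<le> N * (3 * n)" using N by (intro mult_left_mono) auto
      with q have "(\<kappa> * n) * n \<le> (3 * N) * n" by (simp add: power2_eq_square algebra_simps)
      then have "\<kappa> * n \<le> 3 * N" using False by simp
      then have "n \<le> 3 * N / \<kappa>" using \<kappa> by (simp add: field_simps)
      then show ?thesis by (simp add: R_def)
    qed
    have "M * (n + 1) \<le> M * (R + 1)" "K * (n + 1) \<le> K * (R + 1)"
      using nR M K by (auto intro!: mult_left_mono)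
    moreover have "\<kappa> * n\<^sup>2 \<ge> 0" using \<kappa> by simp
    ultimately show ?thesis
      using r Fy T(2) nR by (auto simp: n_def)
  qed
  have "T \<subseteq> cball x R \<times> {- (M * (R + 1)) .. \<alpha> + K * (R + 1)}"
    using bound by (auto simp: dist_norm norm_minus_commute)
  then have "bounded T"
    by (rule bounded_subset[rotated]) (intro bounded_Times bounded_cball bounded_closed_interval)
  moreover have "closed T"
    unfolding T_def using g
    by (intro closed_Int closed_Collect_le cont continuous_on_const)
       (auto simp: proper_closed_convex_def)
  ultimately have "compact T" by (simp add: compact_eq_bounded_closed)
  moreover have T0: "(y0, \<gamma>) \<in> T" by (simp add: T_def ereal_epigraph_def \<gamma> \<alpha>_def)
  ultimately obtain p where p: "p \<in> T"
      "\<And>q. q \<in> T \<Longrightarrow> snd p + F (fst p) \<le> snd q + F (fst q)"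
    using continuous_attains_inf[OF _ _ cont] by (metis empty_iff)
  obtain y r where yr: "p = (y, r)" by (cases p)
  have gy: "g y \<le> ereal r" using p(1) by (simp add: yr T_def ereal_epigraph_def)
  have min: "ereal (r + F y) \<le> g z + ereal (F z)" for z
  proof (cases "g z")
    case (real q)
    show ?thesis
    proof (cases "(z, q) \<in> T")
      case True
      from p(2)[OF this] show ?thesis by (simp add: real yr)
    next
      case False
      then have "\<alpha> < q + F z" by (simp add: T_def ereal_epigraph_def real)
      moreover have "r + F y \<le> \<alpha>" using p(1) by (simp add: yr T_def)
      ultimately show ?thesis by (simp add: real)
    qed
  next
    case MInf
    then show ?thesis using g by (auto simp: proper_closed_convex_def)
  qed simp
  show thesis
  proof
    show "g y + ereal (F y) \<le> g z + ereal (F z)" for z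
      using add_right_mono[OF gy, of "ereal (F y)"] min[of z] by simp
    show "\<bar>g y\<bar> \<noteq> \<infinity>"
      using gy g by (auto simp: proper_closed_convex_def)
  qed
qed

section \<open>Optimality conditions and quadratic growth for penalized problems\<close>

lemma convex_on_norm_diff_square:
  fixes a :: "'a::real_inner"
  shows "convex_on UNIV (\<lambda>y. (norm (y - a))\<^sup>2)"
proof (rule convex_onI)
  fix t :: real and x y :: 'a
  assume t: "0 < t" "t < 1"
  have "(1 - t) * (norm (x - a))\<^sup>2 + t * (norm (y - a))\<^sup>2
      - (norm ((1 - t) *\<^sub>R x + t *\<^sub>R y - a))\<^sup>2 = t * (1 - t) * (norm (x - y))\<^sup>2"
    unfolding power2_norm_eq_inner by (simp add: inner_commute algebra_simps power2_eq_square)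
  moreover have "\<dots> \<ge> 0" using t by simp
  ultimately show "(norm ((1 - t) *\<^sub>R x + t *\<^sub>R y - a))\<^sup>2
      \<le> (1 - t) * (norm (x - a))\<^sup>2 + t * (norm (y - a))\<^sup>2"
    by linarith
qed simp

text \<open>Every subgradient of \<open>S\<close> at \<open>y\<close> is
  \<open>\<mu> *\<^sub>R (y - x)\<close> plus a vector of norm at most \<rho>: the term centred at
  \<open>p\<close> has slope at most \<rho>, and the one centred at \<open>y\<close> has zero
  gradient there.\<close>

lemma penalized_minimizer_subgradient:
  fixes G :: "'a::euclidean_space \<Rightarrow> ereal"
  assumes G: "convex (ereal_epigraph G)" and fin: "\<bar>G y\<bar> \<noteq> \<infinity>"
    and nonneg: "\<mu> \<ge> 0" "\<rho> \<ge> 0" "K \<ge> 0"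
    and S: "\<And>z. S z = \<mu> / 2 * (norm (z - x))\<^sup>2 + \<rho> * norm (z - p) + K * (norm (z - y))\<^sup>2"
    and min: "\<And>z. G y + ereal (S y) \<le> G z + ereal (S z)"
  obtains d where "norm d \<le> \<rho>" "- (\<mu> *\<^sub>R (y - x) + d) \<in> subdiff G y"
proof -
  have "convex_on UNIV (\<lambda>z. norm (z - p))"
    using convex_on_dist[of UNIV p] by (simp add: dist_norm norm_minus_commute)
  then have "convex_on UNIV S"
    unfolding S[abs_def] using nonneg
    by (intro convex_on_add convex_on_cmul convex_on_norm_diff_square) auto
  from composite_minimizer_subgradient[OF G fin this linear_id, of y]
  obtain w where w: "w \<in> subdiff (\<lambda>z. ereal (S z)) y" "\<And>z. G y \<le> G z + ereal (w \<bullet> (z - y))"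
    using min by auto
  define d where "d = w - \<mu> *\<^sub>R (y - x)"
  have "norm d \<le> \<rho>"
  proof (cases "d = 0")
    case True
    then show ?thesis using nonneg by simp
  next
    case False
    define k where "k = (\<mu> / 2 + K) * norm d"
    \<comment> \<open>The subgradient inequality is tested at \<open>y + e *\<^sub>R d\<close>,
      along \<open>d\<close> itself. The first-order part gives \<rho>, and \<open>e * k\<close>
      collects the second-order terms.\<close>
    have "norm d \<le> \<rho> + e * k" if e: "e > 0" for e
    proof -
      have "S y + w \<bullet> (e *\<^sub>R d) \<le> S (y + e *\<^sub>R d)"
        using w(1) by (auto simp: subdiff_def dest: spec[of _ "y + e *\<^sub>R d"])
      moreover have "\<mu> / 2 * (norm (y + e *\<^sub>R d - x))\<^sup>2 =
          \<mu> / 2 * (norm (y - x))\<^sup>2 + e * (\<mu> * ((y - x) \<bullet> d)) + e * e * (\<mu> / 2 * (norm d)\<^sup>2)"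
        unfolding power2_norm_eq_inner
        by (simp add: inner_commute algebra_simps)
      moreover have "norm (y + e *\<^sub>R d - p) \<le> norm (y - p) + e * norm d"
        using norm_triangle_ineq[of "y - p" "e *\<^sub>R d"] e by (simp add: algebra_simps)
      then have "\<rho> * norm (y + e *\<^sub>R d - p) \<le> \<rho> * (norm (y - p) + e * norm d)"
        by (intro mult_left_mono nonneg)
      ultimately have "e * (w \<bullet> d - \<mu> * ((y - x) \<bullet> d)) \<le>
          e * (\<rho> * norm d + e * ((\<mu> / 2 + K) * (norm d)\<^sup>2))"
        using e by (simp add: S algebra_simps power_mult_distrib power2_eq_square)
      then have "w \<bullet> d - \<mu> * ((y - x) \<bullet> d) \<le> \<rho> * norm d + e * ((\<mu> / 2 + K) * (norm d)\<^sup>2)"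
        using e by simp
      moreover have "w \<bullet> d - \<mu> * ((y - x) \<bullet> d) = norm d * norm d"
        using dot_square_norm[of d] by (simp add: d_def inner_diff_left power2_eq_square)
      ultimately have "norm d * norm d \<le> norm d * (\<rho> + e * k)"
        by (simp add: k_def algebra_simps power2_eq_square)
      then show ?thesis using False by simp
    qed
    moreover have "k \<ge> 0" using nonneg by (simp add: k_def)
    ultimately have "norm d \<le> \<rho> + e" if "e > 0" for e
    proof -
      have "norm d \<le> \<rho> + (e / (k + 1)) * k"
        using that \<open>k \<ge> 0\<close> by (intro \<open>\<And>e. e > 0 \<Longrightarrow> norm d \<le> \<rho> + e * k\<close>) simp
      also have "(e / (k + 1)) * k \<le> e" using that \<open>k \<ge> 0\<close> by (simp add: field_simps)
      finally show ?thesis by simp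
    qed
    then show ?thesis by (rule field_le_epsilon)
  qed
  moreover have "- (\<mu> *\<^sub>R (y - x) + d) \<in> subdiff G y"
    unfolding subdiff_def d_def
  proof (safe)
    fix z
    show "G y + ereal (- (\<mu> *\<^sub>R (y - x) + (w - \<mu> *\<^sub>R (y - x))) \<bullet> (z - y)) \<le> G z"
      using w(2)[of z] fin by (cases "G y"; cases "G z") auto
  qed (use fin in auto)
  ultimately show thesis by (rule that)
qed

text \<open>Expanding the square around \<open>y\<close> leaves a cross term that is exactly the
  linear term of the subgradient inequality. This is the strong convexity of the penalized function,
  read off at its minimizer.\<close>

lemma subdiff_quadratic_growth:
  fixes G :: "'a::real_inner \<Rightarrow> ereal"
  assumes "- (\<mu> *\<^sub>R (y - x)) \<in> subdiff G y"
  shows "G z + ereal (\<mu> / 2 * (norm (z - x))\<^sup>2) \<ge>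
    G y + ereal (\<mu> / 2 * (norm (y - x))\<^sup>2 + \<mu> / 2 * (norm (z - y))\<^sup>2)"
proof -
  have "\<mu> / 2 * (norm (y - x))\<^sup>2 + \<mu> / 2 * (norm (z - y))\<^sup>2 =
      \<mu> / 2 * (norm (z - x))\<^sup>2 - \<mu> * ((y - x) \<bullet> (z - y))"
    unfolding power2_norm_eq_inner
    by (simp add: inner_commute algebra_simps power2_eq_square)
  moreover have "G z \<ge> G y + ereal (- (\<mu> * ((y - x) \<bullet> (z - y))))" "\<bar>G y\<bar> \<noteq> \<infinity>"
    using assms by (auto simp: subdiff_def)
  ultimately show ?thesis
    by (cases "G y"; cases "G z") auto
qed

section \<open>Linearization error of a map with Lipschitz Jacobian\<close>

text \<open>Along the segment from \<open>x\<close> to \<open>y\<close>, \<open>f\<close> is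
  \<open>c\<close> minus the linear term at \<open>x\<close>, so its derivative at \<open>s\<close>
  is at most \<open>\<beta> * (norm (y - x))\<^sup>2 * s\<close>. The antiderivative of this bound
  produces the factor 1/2.\<close>

lemma jacobian_Lipschitz_linearization_error:
  fixes c :: "real^'n \<Rightarrow> real^'m"
  assumes diff: "\<And>x. c differentiable (at x)"
    and Lip: "\<And>x y. onorm ((*v) (jacobian c (at x) - jacobian c (at y))) \<le> \<beta> * dist x y"
  shows "norm (c y - (c x + jacobian c (at x) *v (y - x))) \<le> \<beta> / 2 * (norm (y - x))\<^sup>2"
proof -
  define f where "f s = c (x + s *\<^sub>R (y - x)) - s *\<^sub>R (jacobian c (at x) *v (y - x))" for s
  define f' where "f' s = (jacobian c (at (x + s *\<^sub>R (y - x))) - jacobian c (at x)) *v (y - x)" for s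
  have der: "(f has_vector_derivative f' s) (at s)" for s
  proof -
    have "(c has_derivative (\<lambda>k. jacobian c (at (x + s *\<^sub>R (y - x))) *v k)) (at (x + s *\<^sub>R (y - x)))"
      using diff jacobian_works by blast
    then have "((\<lambda>s. c (x + s *\<^sub>R (y - x))) has_derivative
        (\<lambda>r. jacobian c (at (x + s *\<^sub>R (y - x))) *v (r *\<^sub>R (y - x)))) (at s)"
      by (rule has_derivative_compose[rotated]) (auto intro!: derivative_eq_intros)
    then have "(f has_derivative (\<lambda>r. jacobian c (at (x + s *\<^sub>R (y - x))) *v (r *\<^sub>R (y - x))
        - r *\<^sub>R (jacobian c (at x) *v (y - x)))) (at s)"
      unfolding f_def by (auto intro!: derivative_eq_intros)
    then show ?thesis
      unfolding f'_def has_vector_derivative_def matrix_vector_mult_diff_rdistrib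
        matrix_vector_mult_scaleR scaleR_diff_right[symmetric] .
  qed
  have "norm (f 1 - f 0) \<le> \<beta> / 2 * (norm (y - x))\<^sup>2 * 1\<^sup>2 - \<beta> / 2 * (norm (y - x))\<^sup>2 * 0\<^sup>2"
  proof (rule differentiable_bound_general[where f' = f' and \<phi>' = "\<lambda>s. \<beta> * (norm (y - x))\<^sup>2 * s"])
    show "continuous_on {0..1} f"
      using der by (intro continuous_at_imp_continuous_on ballI) (metis has_vector_derivative_continuous)
    fix s :: real assume s: "0 < s" "s < 1"
    show "((\<lambda>s. \<beta> / 2 * (norm (y - x))\<^sup>2 * s\<^sup>2) has_vector_derivative \<beta> * (norm (y - x))\<^sup>2 * s) (at s)"
      unfolding has_real_derivative_iff_has_vector_derivative[symmetric]
      by (auto intro!: derivative_eq_intros)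
    have "norm (f' s) \<le> onorm ((*v) (jacobian c (at (x + s *\<^sub>R (y - x))) - jacobian c (at x))) * norm (y - x)"
      unfolding f'_def by (rule onorm) (rule matrix_vector_mul_bounded_linear)
    also have "\<dots> \<le> \<beta> * dist (x + s *\<^sub>R (y - x)) x * norm (y - x)"
      by (intro mult_right_mono Lip) auto
    also have "\<dots> = \<beta> * (norm (y - x))\<^sup>2 * s"
      using s by (simp add: dist_norm power2_eq_square)
    finally show "norm (f' s) \<le> \<beta> * (norm (y - x))\<^sup>2 * s" .
  qed (use der in \<open>auto intro!: continuous_intros\<close>)
  then show ?thesis by (simp add: f_def algebra_simps)
qed

section \<open>Extended distance to a set\<close>

lemma edist_set_nonneg: "0 \<le> edist_set x S"
  unfolding edist_set_def by (rule INF_greatest) simp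

lemma edist_set_singleton: "edist_set x {y} = ereal (dist x y)"
  by (simp add: edist_set_def)

lemma edist_set_le: "y \<in> S \<Longrightarrow> edist_set x S \<le> ereal (dist x y)"
  unfolding edist_set_def by (rule INF_lower)

text \<open>Moving the finite number \<open>dist x y\<close> to the left lets the infimum on the
  right be bounded termwise, the empty set included.\<close>

lemma edist_set_triangle: "edist_set x S \<le> ereal (dist x y) + edist_set y S"
proof -
  have "edist_set x S - ereal (dist x y) \<le> edist_set y S"
    unfolding edist_set_def[of y]
  proof (rule INF_greatest)
    fix s assume "s \<in> S"
    then have "edist_set x S \<le> ereal (dist x s)" by (rule edist_set_le)
    also have "\<dots> \<le> ereal (dist y s) + ereal (dist x y)"
      using dist_triangle[of x s y] by simp
    finally show "edist_set x S - ereal (dist x y) \<le> ereal (dist y s)"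
      by (simp add: ereal_minus_le)
  qed
  then show ?thesis by (simp add: ereal_minus_le add.commute)
qed

section \<open>The linearized model and its subdifferential\<close>

locale prox_composite =
  fixes g :: "real^'n \<Rightarrow> ereal"
    and h :: "real^'m \<Rightarrow> real"
    and c :: "real^'n \<Rightarrow> real^'m"
    and L \<beta> t :: real
  assumes g: "proper_closed_convex g"
    and h_convex: "convex_on UNIV h"
    and h_Lipschitz: "L-lipschitz_on UNIV h"
    and c_diff: "\<And>x. c differentiable (at x)"
    and jacobian_Lipschitz:
      "\<And>x y. onorm ((*v) (jacobian c (at x) - jacobian c (at y))) \<le> \<beta> * dist x y"
    and t: "t > 0"
begin

abbreviation J where "J x \<equiv> jacobian c (at x)"
abbreviation \<Phi> where "\<Phi> \<equiv> linearized g h c"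
abbreviation prox where "prox \<equiv> prox_point g h c t"

lemma g_not_MInf: "g y \<noteq> -\<infinity>"
  using g by (simp add: proper_closed_convex_def)

lemma L_nonneg: "0 \<le> L"
  using h_Lipschitz by (rule lipschitz_on_nonneg)

text \<open>A unit coordinate vector provides two points at distance 1, and the operator norm on the
  left of the Lipschitz bound is nonnegative.\<close>

lemma \<beta>_nonneg: "0 \<le> \<beta>"
proof -
  define e :: "real^'n" where "e = axis undefined 1"
  have "0 \<le> onorm ((*v) (J 0 - J e))"
    by (rule onorm_pos_le) (rule matrix_vector_mul_bounded_linear)
  also have "\<dots> \<le> \<beta> * dist 0 e" by (rule jacobian_Lipschitz)
  finally show ?thesis by (simp add: e_def)
qed

lemma h_diff_le: "\<bar>h a - h b\<bar> \<le> L * norm (a - b)"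
  using lipschitz_onD[OF h_Lipschitz, of a b] by (simp add: dist_norm)

lemma linearization_model_error:
  "\<bar>h (c y) - h (c x + J x *v (y - x))\<bar> \<le> L * \<beta> / 2 * (norm (y - x))\<^sup>2"
proof -
  have "\<bar>h (c y) - h (c x + J x *v (y - x))\<bar> \<le> L * norm (c y - (c x + J x *v (y - x)))"
    by (rule h_diff_le)
  also have "\<dots> \<le> L * (\<beta> / 2 * (norm (y - x))\<^sup>2)"
    by (intro mult_left_mono L_nonneg
        jacobian_Lipschitz_linearization_error[OF c_diff jacobian_Lipschitz])
  finally show ?thesis by simp
qed

lemma linearized_h_convex: "convex_on UNIV (\<lambda>y. h (c x + J x *v (y - x)))"
proof (rule convex_onI)
  fix s :: real and y z :: "real^'n"
  assume s: "0 < s" "s < 1"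
  have "c x + J x *v ((1 - s) *\<^sub>R y + s *\<^sub>R z - x) =
      (1 - s) *\<^sub>R (c x + J x *v (y - x)) + s *\<^sub>R (c x + J x *v (z - x))"
    by (simp add: matrix_vector_mult_diff_distrib matrix_vector_right_distrib
        matrix_vector_mult_scaleR algebra_simps)
  then show "h (c x + J x *v ((1 - s) *\<^sub>R y + s *\<^sub>R z - x)) \<le>
      (1 - s) * h (c x + J x *v (y - x)) + s * h (c x + J x *v (z - x))"
    using convex_onD[OF h_convex, of s] s by simp
qed simp

lemma linearized_convex: "convex (ereal_epigraph (\<Phi> x))"
proof -
  have "\<Phi> x = (\<lambda>y. g y + ereal (h (c x + J x *v (y - x))))"
    by (simp add: linearized_def fun_eq_iff)
  then show ?thesis
    using ereal_epigraph_add_real_convex[OF _ linearized_h_convex] g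
    by (simp add: proper_closed_convex_def)
qed

lemma linearized_finite: "\<bar>\<Phi> x y\<bar> \<noteq> \<infinity> \<longleftrightarrow> \<bar>g y\<bar> \<noteq> \<infinity>"
  by (cases "g y") (auto simp: linearized_def)

text \<open>One inclusion adds the subgradient inequalities of \<open>g\<close> and
  \<open>h\<close>. For the other, tilting \<open>g\<close> by the linear form of \<open>-v\<close>
  makes \<open>x\<close> a minimizer of a convex composite, and
  \<open>composite_minimizer_subgradient\<close> splits \<open>v\<close>.\<close>

lemma composite_subdiff_eq: "composite_subdiff g h c x = subdiff (\<Phi> x) x"
proof (intro equalityI subsetI)
  fix v assume "v \<in> composite_subdiff g h c x"
  then obtain a w where v: "v = a + transpose (J x) *v w" and a: "a \<in> subdiff g x"
    and w: "w \<in> subdiff (\<lambda>z. ereal (h z)) (c x)"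
    by (auto simp: composite_subdiff_def)
  have "\<Phi> x x + ereal (v \<bullet> (y - x)) \<le> \<Phi> x y" for y
  proof -
    have "h (c x) + w \<bullet> (J x *v (y - x)) \<le> h (c x + J x *v (y - x))"
      using w by (auto simp: subdiff_def dest: spec[of _ "c x + J x *v (y - x)"])
    moreover have "(transpose (J x) *v w) \<bullet> (y - x) = w \<bullet> (J x *v (y - x))"
      by (simp only: transpose_matrix_vector dot_lmul_matrix)
    moreover have "g x + ereal (a \<bullet> (y - x)) \<le> g y" "\<bar>g x\<bar> \<noteq> \<infinity>"
      using a by (auto simp: subdiff_def)
    ultimately show ?thesis
      by (cases "g x"; cases "g y") (auto simp: linearized_def v inner_add_left)
  qed
  then show "v \<in> subdiff (\<Phi> x) x"
    using a by (auto simp: subdiff_def linearized_finite)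
next
  fix v assume v: "v \<in> subdiff (\<Phi> x) x"
  then have fin: "\<bar>g x\<bar> \<noteq> \<infinity>" by (simp add: subdiff_def linearized_finite)
  have "convex_on UNIV (\<lambda>y. - (v \<bullet> y))"
    by (rule convex_onI) (auto simp: inner_simps algebra_simps)
  then have G: "convex (ereal_epigraph (\<lambda>y. g y + ereal (- (v \<bullet> y))))"
    using g by (intro ereal_epigraph_add_real_convex) (auto simp: proper_closed_convex_def)
  have "g x + ereal (- (v \<bullet> x)) + ereal (h (c x)) \<le>
      g y + ereal (- (v \<bullet> y)) + ereal (h (c x + J x *v (y - x)))" for y
  proof -
    have "\<Phi> x x + ereal (v \<bullet> (y - x)) \<le> \<Phi> x y" using v by (simp add: subdiff_def)
    then show ?thesis
      using fin by (cases "g x"; cases "g y") (auto simp: linearized_def inner_simps)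
  qed
  with composite_minimizer_subgradient[OF G _ h_convex matrix_vector_mul_linear[of "J x"], of x "c x"]
  obtain w where w: "w \<in> subdiff (\<lambda>z. ereal (h z)) (c x)"
    "\<And>y. g x + ereal (- (v \<bullet> x)) \<le> g y + ereal (- (v \<bullet> y)) + ereal (w \<bullet> (J x *v (y - x)))"
    using fin by auto
  have "g x + ereal ((v - transpose (J x) *v w) \<bullet> (y - x)) \<le> g y" for y
  proof -
    have "(transpose (J x) *v w) \<bullet> (y - x) = w \<bullet> (J x *v (y - x))"
      by (simp only: transpose_matrix_vector dot_lmul_matrix)
    then show ?thesis
      using w(2)[of y] fin by (cases "g x"; cases "g y") (auto simp: inner_diff_left inner_diff_right[of v])
  qed
  then have "v - transpose (J x) *v w \<in> subdiff g x"
    using fin by (simp add: subdiff_def)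
  with w(1) show "v \<in> composite_subdiff g h c x"
    unfolding composite_subdiff_def by force
qed

section \<open>The prox point, its optimality, and nearby approximately stationary points\<close>

lemma h_continuous: "continuous_on UNIV h"
  using h_Lipschitz by (rule lipschitz_on_continuous_on)

text \<open>Supplies the linear-growth constant required by
  \<open>coercive_minimizer_exists\<close>: the linearized \<open>h\<close> has slope at most
  \<open>L\<close> times the operator norm of \<open>J x\<close>.\<close>

lemma linearized_h_lower_bound:
  obtains K where "K \<ge> 0" "\<And>y. - (K * (norm (y - x) + 1)) \<le> h (c x + J x *v (y - x))"
proof
  define N where "N = onorm ((*v) (J x))"
  have N: "N \<ge> 0" unfolding N_def by (rule onorm_pos_le) (rule matrix_vector_mul_bounded_linear)
  show "0 \<le> \<bar>h (c x)\<bar> + L * N" using N L_nonneg by simp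
  fix y
  have "\<bar>h (c x + J x *v (y - x)) - h (c x)\<bar> \<le> L * norm (J x *v (y - x))"
    using h_diff_le[of "c x + J x *v (y - x)" "c x"] by simp
  also have "\<dots> \<le> L * (N * norm (y - x))"
    unfolding N_def by (intro mult_left_mono L_nonneg onorm matrix_vector_mul_bounded_linear)
  finally have "\<bar>h (c x + J x *v (y - x)) - h (c x)\<bar> \<le> L * (N * norm (y - x))" .
  moreover have "(\<bar>h (c x)\<bar> + L * N) * (norm (y - x) + 1) =
      L * (N * norm (y - x)) + L * N + \<bar>h (c x)\<bar> * norm (y - x) + \<bar>h (c x)\<bar>"
    by (simp add: algebra_simps)
  moreover have "L * N \<ge> 0" "\<bar>h (c x)\<bar> * norm (y - x) \<ge> 0"
    using L_nonneg N by simp_all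
  ultimately show "- ((\<bar>h (c x)\<bar> + L * N) * (norm (y - x) + 1)) \<le> h (c x + J x *v (y - x))"
    by linarith
qed

text \<open>The coefficient \<open>1 / t / 2\<close> matches the form \<open>\<mu> / 2\<close> of
  the growth and penalty lemmas with \<open>\<mu> = 1 / t\<close>.\<close>

lemma prox_model_eq: "prox_model g h c t x y = \<Phi> x y + ereal (1 / t / 2 * (norm (y - x))\<^sup>2)"
  by (simp add: prox_model_def norm_minus_commute mult.commute)

lemma prox_minimizes:
  shows "\<Phi> x (prox x) + ereal (1 / t / 2 * (norm (prox x - x))\<^sup>2)
      \<le> \<Phi> x y + ereal (1 / t / 2 * (norm (y - x))\<^sup>2)" (is ?min)
    and "\<bar>\<Phi> x (prox x)\<bar> \<noteq> \<infinity>" (is ?fin)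
proof -
  obtain K where K: "K \<ge> 0" "\<And>y. - (K * (norm (y - x) + 1)) \<le> h (c x + J x *v (y - x))"
    using linearized_h_lower_bound[of x] by metis
  define F where "F y = h (c x + J x *v (y - x)) + 1 / t / 2 * (norm (y - x))\<^sup>2" for y
  have model: "prox_model g h c t x y = g y + ereal (F y)" for y
    by (cases "g y") (auto simp: prox_model_eq linearized_def F_def)
  have "continuous_on UNIV F"
    unfolding F_def
    by (intro continuous_intros continuous_on_compose2[OF h_continuous]
        linear_continuous_on_compose[OF _ matrix_vector_mul_linear]) auto
  moreover have "1 / t / 2 * (norm (y - x))\<^sup>2 - K * (norm (y - x) + 1) \<le> F y" for y
    using K(2)[of y] by (simp add: F_def)
  ultimately obtain p where p: "\<And>z. g p + ereal (F p) \<le> g z + ereal (F z)" "\<bar>g p\<bar> \<noteq> \<infinity>"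
    using coercive_minimizer_exists[OF g _ _ K(1), of F "1 / t / 2" x] t by auto
  then have "is_arg_min (prox_model g h c t x) (\<lambda>y. True) p"
    by (simp add: is_arg_min_def model not_less)
  \<comment> \<open>Existence of some minimizer \<open>p\<close> is what makes the choice operator
    behind \<open>prox\<close> return a minimizer.\<close>
  then have "is_arg_min (prox_model g h c t x) (\<lambda>y. True) (prox x)"
    unfolding prox_point_def arg_min_def by (rule someI)
  then have le: "g (prox x) + ereal (F (prox x)) \<le> g y + ereal (F y)" for y
    by (auto simp: is_arg_min_def model not_less)
  then show ?min
    unfolding prox_model_eq[symmetric] model .
  show ?fin
    using le[of p] p(2) g_not_MInf[of "prox x"] unfolding linearized_finite
    by (cases "g (prox x)"; cases "g p") auto
qed

text \<open>The penalty lemma with \<open>\<rho> = 0\<close> and \<open>K = 0\<close>, which forces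
  the error vector to vanish.\<close>

lemma prox_subgradient: "- ((1 / t) *\<^sub>R (prox x - x)) \<in> subdiff (\<Phi> x) (prox x)"
proof -
  obtain d where "norm d \<le> 0" "- ((1 / t) *\<^sub>R (prox x - x) + d) \<in> subdiff (\<Phi> x) (prox x)"
    by (rule penalized_minimizer_subgradient[OF linearized_convex prox_minimizes(2), of "1 / t" 0 0
        "\<lambda>z. 1 / t / 2 * (norm (z - x))\<^sup>2" x x]) (use t prox_minimizes(1) in auto)
  then show ?thesis by simp
qed

lemmas prox_growth = subdiff_quadratic_growth[OF prox_subgradient]

text \<open>The prox step lowers the linearized model by at least \<open>r\<^sup>2 / t\<close>, half
  from the proximal term and half from strong convexity, while the subgradient \<open>v\<close>
  allows a decrease of at most \<open>norm v * r\<close>.\<close>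

lemma prox_gradient_le_composite_subdiff:
  assumes "v \<in> composite_subdiff g h c x"
  shows "norm (prox_gradient g h c t x) \<le> norm v"
proof -
  define r where "r = norm (prox x - x)"
  have v: "\<Phi> x x + ereal (v \<bullet> (prox x - x)) \<le> \<Phi> x (prox x)" "\<bar>\<Phi> x x\<bar> \<noteq> \<infinity>"
    using assms by (auto simp: composite_subdiff_eq subdiff_def)
  have "\<Phi> x (prox x) + ereal (1 / t / 2 * r\<^sup>2 + 1 / t / 2 * r\<^sup>2) \<le> \<Phi> x x"
    using prox_growth[of x x] by (simp add: r_def norm_minus_commute)
  then have "1 / t * r\<^sup>2 \<le> - (v \<bullet> (prox x - x))"
    using v by (cases "\<Phi> x x"; cases "\<Phi> x (prox x)") auto
  also have "\<dots> \<le> norm v * r"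
    using Cauchy_Schwarz_ineq2[of v "prox x - x"] by (simp add: r_def)
  finally have "(1 / t * r) * r \<le> norm v * r" by (simp add: power2_eq_square)
  moreover have "r \<ge> 0" by (simp add: r_def)
  ultimately have "1 / t * r \<le> norm v"
    by (cases "r = 0") (simp, metis mult_right_le_imp_le order_le_less)
  then show ?thesis
    using t by (simp add: prox_gradient_def r_def norm_minus_commute)
qed

lemma prox_gradient_zero_iff: "prox_gradient g h c t x = 0 \<longleftrightarrow> 0 \<in> composite_subdiff g h c x"
proof
  assume "prox_gradient g h c t x = 0"
  then have "prox x = x" using t by (simp add: prox_gradient_def)
  with prox_subgradient[of x] show "0 \<in> composite_subdiff g h c x"
    by (simp add: composite_subdiff_eq)
next
  assume "0 \<in> composite_subdiff g h c x"
  from prox_gradient_le_composite_subdiff[OF this] show "prox_gradient g h c t x = 0" by simp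
qed

text \<open>The point \<open>y\<close> minimizes a global upper bound of the proximal model plus a multiple of the
  distance to \<open>prox x\<close>. In finite dimensions this replaces Ekeland's variational principle, since
  the minimum is attained.\<close>

lemma near_stationary_point:
  obtains y v where "norm (y - prox x) \<le> norm (prox x - x)"
    "v \<in> composite_subdiff g h c y" "norm v \<le> (3 * (L * \<beta>) + 2 / t) * norm (prox x - x)"
proof -
  define p where "p = prox x"
  define r where "r = norm (p - x)"
  define B where "B = L * \<beta>"
  \<comment> \<open>The extra curvature \<open>B\<close> in \<mu> pays for the linearization error,
    so that \<open>F\<close> dominates the proximal model. The slope \<rho> is chosen so that the
    total defect \<open>B * r\<^sup>2\<close> in the comparison of \<open>y\<close> with
    \<open>p\<close> equals \<open>\<rho> * r\<close>.\<close>
  define \<mu> where "\<mu> = B + 1 / t"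
  define \<rho> where "\<rho> = B * r"
  have B: "B \<ge> 0" using L_nonneg \<beta>_nonneg by (simp add: B_def)
  have r: "r \<ge> 0" by (simp add: r_def)
  have \<rho>: "\<rho> \<ge> 0" using B r by (simp add: \<rho>_def)
  have \<mu>: "\<mu> \<ge> 0" using B t by (simp add: \<mu>_def)
  have err: "\<bar>h (c y) - h (c x + J x *v (y - x))\<bar> \<le> B / 2 * (norm (y - x))\<^sup>2" for x y
    using linearization_model_error[of y x] by (simp add: B_def)
  have \<mu>_split: "\<mu> / 2 * a = B / 2 * a + 1 / t / 2 * a" for a
    by (simp add: \<mu>_def field_simps)
  define F where "F y = h (c y) + \<mu> / 2 * (norm (y - x))\<^sup>2 + \<rho> * norm (y - p)" for y
  have F_lower: "h (c x + J x *v (y - x)) + 1 / t / 2 * (norm (y - x))\<^sup>2 + \<rho> * norm (y - p) \<le> F y" for y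
    using err[of y x] \<mu>_split[of "(norm (y - x))\<^sup>2"] unfolding F_def by linarith
  obtain K where K: "K \<ge> 0" "\<And>y. - (K * (norm (y - x) + 1)) \<le> h (c x + J x *v (y - x))"
    using linearized_h_lower_bound[of x] by metis
  have "continuous_on UNIV c"
    using c_diff by (simp add: continuous_at_imp_continuous_on differentiable_imp_continuous_within)
  then have "continuous_on UNIV F"
    unfolding F_def by (intro continuous_intros continuous_on_compose2[OF h_continuous]) auto
  moreover have "1 / t / 2 * (norm (y - x))\<^sup>2 - K * (norm (y - x) + 1) \<le> F y" for y
    using K(2)[of y] F_lower[of y] mult_nonneg_nonneg[OF \<rho> norm_ge_zero[of "y - p"]] by simp
  ultimately obtain y where y: "\<And>z. g y + ereal (F y) \<le> g z + ereal (F z)" "\<bar>g y\<bar> \<noteq> \<infinity>"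
    using coercive_minimizer_exists[OF g _ _ K(1), of F "1 / t / 2" x] t by auto
  define d where "d = norm (y - p)"
  have d: "d \<le> r"
  proof (rule ccontr)
    assume "\<not> d \<le> r"
    have "\<bar>g p\<bar> \<noteq> \<infinity>" using prox_minimizes(2)[of x] by (simp add: linearized_finite p_def)
    then obtain \<gamma> \<gamma>p where \<gamma>: "g y = ereal \<gamma>" "g p = ereal \<gamma>p" using y(2) by auto
    \<comment> \<open>Growth of the proximal model around \<open>p\<close> supplies the term in
      \<open>d\<^sup>2\<close>, whose positivity yields the contradiction.\<close>
    have "\<gamma>p + h (c x + J x *v (p - x)) + 1 / t / 2 * r\<^sup>2 + 1 / t / 2 * d\<^sup>2
        \<le> \<gamma> + h (c x + J x *v (y - x)) + 1 / t / 2 * (norm (y - x))\<^sup>2"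
      using prox_growth[of x y] by (simp add: linearized_def \<gamma> r_def d_def flip: p_def)
    moreover have "\<gamma> + F y \<le> \<gamma>p + F p" using y(1)[of p] by (simp add: \<gamma>)
    moreover have "F p = h (c p) + B / 2 * r\<^sup>2 + 1 / t / 2 * r\<^sup>2"
      using \<mu>_split[of "r\<^sup>2"] by (simp add: F_def r_def)
    ultimately have "1 / t / 2 * d\<^sup>2 + \<rho> * d \<le> B / 2 * r\<^sup>2 + B / 2 * r\<^sup>2"
      using F_lower[of y] abs_le_D1[OF err[of p x]] unfolding d_def r_def by linarith
    also have "\<dots> = \<rho> * r" by (simp add: \<rho>_def power2_eq_square)
    also have "\<dots> \<le> \<rho> * d" using \<open>\<not> d \<le> r\<close> \<rho> by (intro mult_left_mono) auto
    finally have "1 / t / 2 * d\<^sup>2 \<le> 0" by simp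
    moreover have "1 / t / 2 * d\<^sup>2 > 0" using \<open>\<not> d \<le> r\<close> r t by simp
    ultimately show False by simp
  qed
  text \<open>Replacing \<open>h \<circ> c\<close> by its linearization at \<open>y\<close>, at the price of a quadratic centred at \<open>y\<close>,
    makes the problem convex and keeps \<open>y\<close> a minimizer.\<close>
  define S where "S z = \<mu> / 2 * (norm (z - x))\<^sup>2 + \<rho> * norm (z - p) + B / 2 * (norm (z - y))\<^sup>2" for z
  have "\<Phi> y y + ereal (S y) \<le> \<Phi> y z + ereal (S z)" for z
    using y(1)[of z] y(2) abs_le_D1[OF err[of z y]]
    by (cases "g y"; cases "g z") (auto simp: linearized_def S_def F_def)
  then obtain e where e: "norm e \<le> \<rho>" "- (\<mu> *\<^sub>R (y - x) + e) \<in> subdiff (\<Phi> y) y"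
    using penalized_minimizer_subgradient[OF linearized_convex _ \<mu> \<rho> _ S_def] B y(2)
    by (metis linearized_finite half_gt_zero_iff divide_nonneg_pos zero_less_numeral)
  show thesis
  proof (rule that)
    show "norm (y - prox x) \<le> norm (prox x - x)" using d by (simp add: d_def r_def p_def)
    show "- (\<mu> *\<^sub>R (y - x) + e) \<in> composite_subdiff g h c y" using e by (simp add: composite_subdiff_eq)
    \<comment> \<open>The final constant: \<open>norm (y - x) \<le> 2 * r\<close> turns the \<mu>
      part into \<open>(2 * B + 2 / t) * r\<close>, and \<rho> adds \<open>B * r\<close>.\<close>
    have "norm (- (\<mu> *\<^sub>R (y - x) + e)) \<le> \<mu> * norm (y - x) + \<rho>"
      unfolding norm_minus_cancel using norm_triangle_ineq[of "\<mu> *\<^sub>R (y - x)" e] e(1) \<mu> by simp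
    also have "norm (y - x) \<le> 2 * r"
      using norm_triangle_ineq[of "y - p" "p - x"] d by (simp add: d_def r_def)
    then have "\<mu> * norm (y - x) + \<rho> \<le> \<mu> * (2 * r) + \<rho>" using \<mu> by (simp add: mult_left_mono)
    also have "\<dots> = (3 * B + 2 / t) * r" by (simp add: \<mu>_def \<rho>_def algebra_simps)
    finally show "norm (- (\<mu> *\<^sub>R (y - x) + e)) \<le> (3 * (L * \<beta>) + 2 / t) * norm (prox x - x)"
      by (simp add: B_def r_def p_def)
  qed
qed

section \<open>Length of the prox step near a stationary point\<close>

text \<open>The two linearizations differ at \<open>y\<close> by
  \<open>(J x - J z) *v (y - x)\<close> plus the error at \<open>x\<close> of the linearization
  based at \<open>z\<close>. The estimate moves comparisons from the model at \<open>x\<close> to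
  the model at \<open>z\<close>.\<close>

lemma linearized_h_diff_le:
  "\<bar>h (c x + J x *v (y - x)) - h (c z + J z *v (y - z))\<bar>
    \<le> L * \<beta> * (norm (x - z) * norm (y - x) + (norm (x - z))\<^sup>2 / 2)"
proof -
  let ?E = "c x - (c z + J z *v (x - z))"
  have "c x + J x *v (y - x) - (c z + J z *v (y - z)) = (J x - J z) *v (y - x) + ?E"
    by (simp add: matrix_vector_mult_diff_rdistrib matrix_vector_mult_diff_distrib)
  then have "\<bar>h (c x + J x *v (y - x)) - h (c z + J z *v (y - z))\<bar>
      \<le> L * norm ((J x - J z) *v (y - x) + ?E)"
    using h_diff_le by metis
  also have "norm ((J x - J z) *v (y - x) + ?E)
      \<le> \<beta> * (norm (x - z) * norm (y - x) + (norm (x - z))\<^sup>2 / 2)"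
  proof -
    have "norm ((J x - J z) *v (y - x)) \<le> onorm ((*v) (J x - J z)) * norm (y - x)"
      by (rule onorm) (rule matrix_vector_mul_bounded_linear)
    also have "\<dots> \<le> \<beta> * dist x z * norm (y - x)"
      by (intro mult_right_mono jacobian_Lipschitz) auto
    finally have "norm ((J x - J z) *v (y - x)) \<le> \<beta> * (norm (x - z) * norm (y - x))"
      by (simp add: dist_norm)
    moreover have "norm ?E \<le> \<beta> * ((norm (x - z))\<^sup>2 / 2)"
      using jacobian_Lipschitz_linearization_error[OF c_diff jacobian_Lipschitz, of x z] by simp
    ultimately show ?thesis
      using norm_triangle_ineq[of "(J x - J z) *v (y - x)" ?E] unfolding distrib_left by linarith
  qed
  finally show ?thesis
    using L_nonneg by (simp add: mult_left_mono mult.assoc)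
qed

text \<open>Optimality of \<open>z\<close> in its own model is played against the growth of the
  proximal model at \<open>x\<close>. The model switch costs only terms with a factor
  \<open>norm (x - z)\<close>, so a quadratic inequality for the step length gives a linear
  bound.\<close>

lemma prox_step_linear_bound:
  assumes "0 \<in> composite_subdiff g h c z"
  shows "norm (prox x - x) \<le> (1 + 6 * (L * \<beta> * t)) * norm (x - z)"
proof (rule ccontr)
  define p where "p = prox x"
  define r where "r = norm (p - x)"
  define \<delta> where "\<delta> = norm (x - z)"
  define B where "B = L * \<beta>"
  have B: "B \<ge> 0" using L_nonneg \<beta>_nonneg by (simp add: B_def)
  have \<delta>: "\<delta> \<ge> 0" by (simp add: \<delta>_def)
  assume "\<not> ?thesis"
  then have less: "(1 + 6 * (B * t)) * \<delta> < r" by (simp add: r_def \<delta>_def B_def p_def)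
  have zmin: "\<Phi> z z \<le> \<Phi> z p" and "\<bar>g z\<bar> \<noteq> \<infinity>"
    using assms by (auto simp: composite_subdiff_eq subdiff_def linearized_finite zero_ereal_def[symmetric])
  moreover have "\<bar>g p\<bar> \<noteq> \<infinity>" using prox_minimizes(2)[of x] by (simp add: linearized_finite p_def)
  ultimately obtain \<gamma> \<gamma>p where \<gamma>: "g z = ereal \<gamma>" "g p = ereal \<gamma>p" by auto
  have 1: "\<gamma>p + h (c x + J x *v (p - x)) + 1 / t / 2 * r\<^sup>2 + 1 / t / 2 * (norm (z - p))\<^sup>2
        \<le> \<gamma> + h (c x + J x *v (z - x)) + 1 / t / 2 * \<delta>\<^sup>2"
    using prox_growth[of x z]
    by (simp add: linearized_def \<gamma> r_def \<delta>_def norm_minus_commute[of x z] flip: p_def)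
  have 2: "\<gamma> + h (c z) \<le> \<gamma>p + h (c z + J z *v (p - z))"
    using zmin by (simp add: linearized_def \<gamma>)
  have 3: "h (c x + J x *v (z - x)) \<le> h (c z) + B * (\<delta> * \<delta> + \<delta>\<^sup>2 / 2)"
    using linearized_h_diff_le[of x z z] by (simp add: B_def \<delta>_def norm_minus_commute[of x z])
  have 4: "h (c z + J z *v (p - z)) \<le> h (c x + J x *v (p - x)) + B * (\<delta> * r + \<delta>\<^sup>2 / 2)"
    using linearized_h_diff_le[of x p z] by (simp add: B_def \<delta>_def r_def)
  have 5: "1 / t / 2 * (norm (z - p))\<^sup>2 \<ge> 0" using t by simp
  \<comment> \<open>Adding the four inequalities cancels all values of \<open>g\<close> and
    \<open>h\<close>.\<close>
  have "1 / t / 2 * r\<^sup>2 \<le> 1 / t / 2 * \<delta>\<^sup>2 + B * (2 * \<delta> * \<delta> + \<delta> * r)"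
    using 1 2 3 4 5 by (simp add: algebra_simps power2_eq_square)
  then have "2 * t * (1 / t / 2 * r\<^sup>2) \<le> 2 * t * (1 / t / 2 * \<delta>\<^sup>2 + B * (2 * \<delta> * \<delta> + \<delta> * r))"
    using t by (intro mult_left_mono) auto
  then have q: "r * r \<le> \<delta> * \<delta> + B * t * (4 * \<delta> * \<delta> + 2 * \<delta> * r)"
    using t by (simp add: algebra_simps power2_eq_square)
  have "\<delta> \<le> (1 + 6 * (B * t)) * \<delta>" using B t \<delta> by (simp add: mult_le_cancel_right1)
  then have "\<delta> < r" using less by simp
  \<comment> \<open>In the case to be refuted \<open>\<delta> < r\<close>, so
    \<open>4 * \<delta> * \<delta> + 2 * \<delta> * r\<close> is at most
    \<open>6 * (\<delta> * r)\<close>; this is the origin of the 6.\<close>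
  then have "\<delta> * \<delta> \<le> \<delta> * r" using \<delta> by (intro mult_left_mono) auto
  moreover from this have "B * t * (4 * \<delta> * \<delta> + 2 * \<delta> * r) \<le> B * t * (6 * (\<delta> * r))"
    using B t by (intro mult_left_mono) auto
  ultimately have "r * r \<le> ((1 + 6 * (B * t)) * \<delta>) * r"
    using q by (simp add: algebra_simps)
  also have "\<dots> < r * r" using less \<open>\<delta> < r\<close> \<delta> by (intro mult_strict_right_mono) auto
  finally show False by simp
qed

section \<open>The two subregularity implications\<close>

text \<open>Both mappings have the same zero set, so only the residuals on the right need to be
  compared.\<close>

lemma composite_subdiff_subregular:
  assumes "subregular (\<lambda>x. {prox_gradient g h c t x}) xbar 0 lhat"
  shows "subregular (composite_subdiff g h c) xbar 0 (2 * lhat)"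
proof -
  have lhat: "lhat > 0" and stationary: "0 \<in> composite_subdiff g h c xbar"
    using assms by (auto simp: subregular_def prox_gradient_zero_iff[symmetric])
  have "\<forall>\<^sub>F x in nhds xbar. edist_set x {z. 0 \<in> composite_subdiff g h c z}
      \<le> ereal lhat * edist_set 0 {prox_gradient g h c t x}"
    using assms unfolding subregular_def
    by (simp add: eq_commute[of 0 "prox_gradient g h c t _"] prox_gradient_zero_iff)
  then have "\<forall>\<^sub>F x in nhds xbar. edist_set x {z. 0 \<in> composite_subdiff g h c z}
      \<le> ereal (2 * lhat) * edist_set 0 (composite_subdiff g h c x)"
  proof eventually_elim
    case (elim x)
    note elim
    also have "edist_set 0 {prox_gradient g h c t x} \<le> edist_set 0 (composite_subdiff g h c x)"
      unfolding edist_set_singleton edist_set_def[of 0 "composite_subdiff g h c x"]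
      by (rule INF_greatest) (simp add: prox_gradient_le_composite_subdiff)
    then have "ereal lhat * edist_set 0 {prox_gradient g h c t x}
        \<le> ereal lhat * edist_set 0 (composite_subdiff g h c x)"
      using lhat by (intro ereal_mult_left_mono) auto
    \<comment> \<open>The constant \<open>lhat\<close> reached so far is relaxed to
      \<open>2 * lhat\<close>.\<close>
    also have "\<dots> \<le> ereal (2 * lhat) * edist_set 0 (composite_subdiff g h c x)"
      using lhat by (intro ereal_mult_right_mono edist_set_nonneg) auto
    finally show ?case .
  qed
  then show ?thesis
    using lhat stationary by (simp add: subregular_def)
qed

lemma prox_gradient_subregular:
  assumes "subregular (composite_subdiff g h c) xbar 0 l"
  shows "subregular (\<lambda>x. {prox_gradient g h c t x}) xbar 0 ((3 * L * \<beta> * t + 2) * l + 2 * t)"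
proof -
  let ?S = "{z. 0 \<in> composite_subdiff g h c z}"
  define C where "C = 1 + 6 * (L * \<beta> * t)"
  have L\<beta>t: "0 \<le> L * \<beta> * t" using L_nonneg \<beta>_nonneg t by simp
  then have C: "C > 0" by (simp add: C_def)
  have l: "l > 0" and stationary: "0 \<in> composite_subdiff g h c xbar"
    using assms by (auto simp: subregular_def)
  obtain d where d: "d > 0" "\<And>x. dist x xbar < d \<Longrightarrow>
      edist_set x ?S \<le> ereal l * edist_set 0 (composite_subdiff g h c x)"
    using assms by (auto simp: subregular_def eventually_nhds_metric)
  have "edist_set x ?S \<le>
      ereal ((3 * L * \<beta> * t + 2) * l + 2 * t) * edist_set 0 {prox_gradient g h c t x}"
    \<comment> \<open>The radius keeps \<open>y\<close> in the ball where subregularity is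
      available: \<open>norm (y - xbar)\<close> is at most
      \<open>(2 * C + 1) * norm (x - xbar)\<close>.\<close>
    if x: "dist x xbar < d / (2 * C + 1)" for x
  proof -
    define r where "r = norm (prox x - x)"
    have r: "r \<le> C * norm (x - xbar)"
      using prox_step_linear_bound[OF stationary, of x] by (simp add: r_def C_def)
    have G: "r = t * norm (prox_gradient g h c t x)"
      using t by (simp add: prox_gradient_def r_def norm_minus_commute)
    obtain y v where y: "norm (y - prox x) \<le> r" "v \<in> composite_subdiff g h c y"
      "norm v \<le> (3 * (L * \<beta>) + 2 / t) * r"
      using near_stationary_point[of x] unfolding r_def by metis
    have yx: "norm (y - x) \<le> 2 * r"
      using norm_triangle_ineq[of "y - prox x" "prox x - x"] y(1) by (simp add: r_def)
    have "norm (y - xbar) \<le> norm (y - x) + norm (x - xbar)"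
      using norm_triangle_ineq[of "y - x" "x - xbar"] by simp
    also have "\<dots> \<le> (2 * C + 1) * norm (x - xbar)"
      using yx r by (simp add: algebra_simps)
    also have "\<dots> < d" using x C by (simp add: dist_norm field_simps)
    finally have near: "dist y xbar < d" by (simp add: dist_norm)
    have "edist_set x ?S \<le> ereal (dist x y) + edist_set y ?S"
      by (rule edist_set_triangle)
    also have "\<dots> \<le> ereal (dist x y) + ereal l * edist_set 0 (composite_subdiff g h c y)"
      by (intro add_left_mono d(2) near)
    also have "\<dots> \<le> ereal (dist x y) + ereal l * ereal (norm v)"
      using l edist_set_le[OF y(2), of 0]
      by (intro add_left_mono ereal_mult_left_mono) auto
    also have "\<dots> \<le> ereal (2 * r + l * ((3 * (L * \<beta>) + 2 / t) * r))"
      using yx y(3) l by (auto simp: dist_norm norm_minus_commute intro!: add_mono mult_left_mono)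
    \<comment> \<open>Substituting \<open>r = t * norm (prox_gradient g h c t x)\<close> turns
      \<open>2 * r\<close> into the summand \<open>2 * t\<close> and cancels the \<open>t\<close> in
      \<open>2 / t\<close>.\<close>
    also have "2 * r + l * ((3 * (L * \<beta>) + 2 / t) * r) =
        ((3 * L * \<beta> * t + 2) * l + 2 * t) * norm (prox_gradient g h c t x)"
      using t by (simp add: G field_simps)
    finally show ?thesis by (simp add: edist_set_singleton)
  qed
  moreover have "d / (2 * C + 1) > 0" using d(1) C by simp
  ultimately have "\<forall>\<^sub>F x in nhds xbar. edist_set x ?S \<le>
      ereal ((3 * L * \<beta> * t + 2) * l + 2 * t) * edist_set 0 {prox_gradient g h c t x}"
    unfolding eventually_nhds_metric by blast
  moreover have "(3 * L * \<beta> * t + 2) * l + 2 * t > 0"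
    using L\<beta>t l t by (simp add: add_nonneg_pos mult.assoc)
  ultimately show ?thesis
    using stationary unfolding subregular_def
    by (simp add: eq_commute[of 0 "prox_gradient g h c t _"] prox_gradient_zero_iff)
qed

end

theorem theorem5p10:
  fixes g :: "real^'n \<Rightarrow> ereal"
    and h :: "real^'m \<Rightarrow> real"
    and c :: "real^'n \<Rightarrow> real^'m"
    and L \<beta> t :: real
    and xbar :: "real^'n"
  assumes g: "proper_closed_convex g"
    and h_convex: "convex_on UNIV h"
    and h_Lipschitz: "L-lipschitz_on UNIV h"
    and c_diff: "\<And>x. c differentiable (at x)"
    and c_C1: "continuous_on UNIV (\<lambda>x. jacobian c (at x))"
    and jacobian_Lipschitz:
      "\<And>x y. onorm ((*v) (jacobian c (at x) - jacobian c (at y))) \<le> \<beta> * dist x y"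
    and t: "t > 0"
    and stationary: "0 \<in> composite_subdiff g h c xbar"
  shows "(\<forall>lhat. subregular (\<lambda>x. {prox_gradient g h c t x}) xbar 0 lhat \<longrightarrow>
                 subregular (composite_subdiff g h c) xbar 0 (2 * lhat)) \<and>
         (\<forall>l. subregular (composite_subdiff g h c) xbar 0 l \<longrightarrow>
              subregular (\<lambda>x. {prox_gradient g h c t x}) xbar 0
                ((3 * L * \<beta> * t + 2) * l + 2 * t))"
proof -
  interpret prox_composite g h c L \<beta> t
    by unfold_locales (fact g h_convex h_Lipschitz c_diff jacobian_Lipschitz t)+
  show ?thesis
    using composite_subdiff_subregular prox_gradient_subregular by blast
qed

end
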